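(* Let $X=\{0,1\}$ and let $a,b,c,d\in\mathrm{Aut}(X^* )$ be the automorphisms of the rooted binary tree defined by the wreath recursion $a=(b,d)\sigma$, $b=(d,b)\sigma$, $c=(a,c)$, $d=(c,a)$. Then $a,b,c,d$ all lie in $\mathrm{Aff}_{[[t]]}(X^* )$ and are induced by the affine transformations $$a=\tau_{\frac{t^2+t+1}{t^2+1},\,\frac{1}{(t+1)^3}},\qquad b=\tau_{\frac{t^2+t+1}{t^2+1},\,\frac{t^2+t+1}{(t+1)^3}},$$ $$c=\tau_{\frac{t^2+t+1}{t^2+1},\,\frac{t}{(t+1)^3}},\qquad d=\tau_{\frac{t^2+t+1}{t^2+1},\,\frac{t^2}{(t+1)^3}},$$ where the fractions are elements of the ring $\mathbb Z_2[[t]]$.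
   Context: $\mathbb Z_2=\mathbb Z/2\mathbb Z$. $X^*$ is the rooted binary tree of finite words over $X=\{0,1\}$; its boundary $X^\infty$ is the set of infinite words, on which automorphisms of $X^*$ act. For $g\in\mathrm{Aut}(X^* )$, writing $g=(g_0,g_1)\rho$ with $\rho$ a permutation of $\{0,1\}$ means $g(xv)=\rho(x)\,g_x(v)$ for $x\in X$, $v\in X^*$; $\sigma=(01)$ is the transposition, and $\rho$ is omitted when trivial. The wreath recursion in the claim uniquely determines $a,b,c,d$. Identify $X^\infty$ with $\mathbb Z_2[[t]]$ by $a_0a_1a_2\ldots\leftrightarrow a_0+a_1t+a_2t^2+\cdots$. For $f,g\in\mathbb Z_2[[t]]$ with $f$ a unit (constant term $1$), the affine transformation $\tau_{f,g}\colon h(t)\mapsto g(t)+h(t)f(t)$ of $\mathbb Z_2[[t]]$ induces, under this identification, an automorphism of $X^*$, also denoted $\tau_{f,g}$. $\mathrm{Aff}_{[[t]]}(X^* )$ denotes the group of all automorphisms $\tau_{f,g}$ of $X^*$ with $f,g\in\mathbb Z_2[[t]]$, $f$ a unit. *)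

theory Defs
  imports
    "HOL-Library.Z2"
    "HOL-Computational_Algebra.Formal_Power_Series"
    "HOL-Combinatorics.Transposition"
begin

type_synonym word = "bit list"

definition tree_adj :: "word \<Rightarrow> word \<Rightarrow> bool" where
  "tree_adj v w \<longleftrightarrow> (\<exists>x. w = v @ [x]) \<or> (\<exists>x. v = w @ [x])"

definition Aut_tree :: "(word \<Rightarrow> word) set" where
  "Aut_tree = {g. bij g \<and> g [] = [] \<and> (\<forall>v w. tree_adj (g v) (g w) \<longleftrightarrow> tree_adj v w)}"

definition wreath_eq ::
  "(word \<Rightarrow> word) \<Rightarrow> (word \<Rightarrow> word) \<Rightarrow> (word \<Rightarrow> word) \<Rightarrow> (bit \<Rightarrow> bit) \<Rightarrow> bool" where
  \<comment> \<open>the paper's notation \<open>g = (g\<^sub>0, g\<^sub>1)\<rho>\<close>, with \<open>\<rho>\<close> applied to the first letter\<close>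
  "wreath_eq g g0 g1 \<rho> \<longleftrightarrow>
     (\<forall>v. g (0 # v) = \<rho> 0 # g0 v) \<and> (\<forall>v. g (1 # v) = \<rho> 1 # g1 v)"

definition boundary_act :: "(word \<Rightarrow> word) \<Rightarrow> (nat \<Rightarrow> bit) \<Rightarrow> (nat \<Rightarrow> bit)" where
  \<comment> \<open>the infinite word whose finite prefixes are the images under \<open>g\<close> of those of \<open>u\<close>\<close>
  "boundary_act g u = (\<lambda>n. g (map u [0..<Suc n]) ! n)"

definition induced_by :: "(word \<Rightarrow> word) \<Rightarrow> (bit fps \<Rightarrow> bit fps) \<Rightarrow> bool" where
  \<comment> \<open>\<open>Abs_fps\<close> is the identification of infinite words with power series\<close>
  "induced_by \<phi> T \<longleftrightarrow> \<phi> \<in> Aut_tree \<and> (\<forall>u. Abs_fps (boundary_act \<phi> u) = T (Abs_fps u))"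

definition tau :: "bit fps \<Rightarrow> bit fps \<Rightarrow> (word \<Rightarrow> word)" where
  \<comment> \<open>for a unit \<open>f\<close> there is exactly one such automorphism, by \<open>ex1_induced_by_affine\<close> below\<close>
  "tau f g = (THE \<phi>. induced_by \<phi> (\<lambda>h. g + h * f))"

definition Aff_tree :: "(word \<Rightarrow> word) set" where
  "Aff_tree = {tau f g | f g. is_unit f}"

lemma Aut_tree_append:
  assumes g: "g \<in> Aut_tree"
  shows "\<exists>y. g (v @ [x]) = g v @ [y]"
proof (induction v arbitrary: x rule: rev_induct)
  have adj: "tree_adj (g v) (g (v @ [x]))" for v x
    using g unfolding Aut_tree_def tree_adj_def by blast
  {
    case Nil
    show ?case using adj[of "[]" x] g by (auto simp: tree_adj_def Aut_tree_def)
  next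
    case (snoc y u)
    from snoc obtain z where z: "g (u @ [y]) = g u @ [z]" by blast
    from adj[of "u @ [y]" x] consider
      "\<exists>x'. g ((u @ [y]) @ [x]) = g (u @ [y]) @ [x']"
      | x' where "g (u @ [y]) = g ((u @ [y]) @ [x]) @ [x']"
      unfolding tree_adj_def by blast
    then show ?case
    proof cases
      case 2
      with z have "g ((u @ [y]) @ [x]) = g u" by simp
      moreover have "inj g" using g by (auto simp: Aut_tree_def bij_def)
      ultimately show ?thesis by (auto dest: injD)
    qed
  }
qed

lemma Aut_tree_length: "g \<in> Aut_tree \<Longrightarrow> length (g v) = length v"
proof (induction v rule: rev_induct)
  case Nil
  then show ?case by (simp add: Aut_tree_def)
next
  case (snoc x xs)
  then show ?case using Aut_tree_append[of g xs x] by auto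
qed

lemma Aut_treeI:
  assumes inj: "inj g" and len: "\<And>v. length (g v) = length v"
    and app: "\<And>v x. \<exists>y. g (v @ [x]) = g v @ [y]"
  shows "g \<in> Aut_tree"
proof -
  have "surj g"
    unfolding surj_def
  proof
    fix w :: word
    let ?S = "{v. set v \<subseteq> (UNIV :: bit set) \<and> length v = length w}"
    have "(UNIV :: bit set) = {0, 1}" by (auto intro: bit.exhaust)
    then have "finite (UNIV :: bit set)" by (metis finite.emptyI finite.insertI)
    then have fin: "finite ?S" by (rule finite_lists_length_eq)
    have "g ` ?S \<subseteq> ?S" using len by auto
    moreover have "inj_on g ?S" using inj by (rule inj_on_subset) simp
    ultimately have "g ` ?S = ?S" using fin endo_inj_surj by blast
    moreover have "w \<in> {v. set v \<subseteq> UNIV \<and> length v = length w}" by simp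
    ultimately have "w \<in> g ` ?S" by (simp only:)
    then show "\<exists>v. w = g v" by blast
  qed
  then have "bij g" using inj by (simp add: bij_def)
  moreover have "g [] = []" using len[of "[]"] by simp
  moreover have step: "(\<exists>x. g w = g v @ [x]) \<longleftrightarrow> (\<exists>x. w = v @ [x])" for v w
  proof
    assume "\<exists>x. g w = g v @ [x]"
    then obtain x where x: "g w = g v @ [x]" by blast
    then have "length w = Suc (length v)" using len by (metis length_append_singleton)
    then have "w \<noteq> []" by auto
    then obtain w' y where w: "w = w' @ [y]" by (metis rev_exhaust)
    with x app[of w' y] have "g w' = g v" by auto
    with inj w show "\<exists>x. w = v @ [x]" by (auto dest: injD)
  qed (use app in blast)
  ultimately show ?thesis by (simp add: Aut_tree_def tree_adj_def)
qed

lemma boundary_act_prefix: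
  assumes g: "g \<in> Aut_tree"
  shows "g (map u [0..<n]) = map (boundary_act g u) [0..<n]"
proof (induction n)
  case 0
  show ?case using g by (simp add: Aut_tree_def)
next
  case (Suc n)
  obtain y where y: "g (map u [0..<n] @ [u n]) = g (map u [0..<n]) @ [y]"
    using Aut_tree_append[OF g] by blast
  then have "boundary_act g u n = y"
    using Aut_tree_length[OF g] by (simp add: boundary_act_def nth_append)
  with y Suc show ?case by simp
qed

lemma boundary_act_inject:
  assumes "g \<in> Aut_tree" "h \<in> Aut_tree" "boundary_act g = boundary_act h"
  shows "g = h"
proof
  fix v :: word
  have "v = map (\<lambda>i. v ! i) [0..<length v]" by (simp add: map_nth)
  then show "g v = h v"
    using boundary_act_prefix[of g "\<lambda>i. v ! i" "length v"]
      boundary_act_prefix[of h "\<lambda>i. v ! i" "length v"] assms by simp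
qed

lemma ex1_induced_by_affine:
  fixes f g :: "bit fps"
  assumes "is_unit f"
  shows "\<exists>!\<phi>. induced_by \<phi> (\<lambda>h. g + h * f)"
proof (rule ex_ex1I)
  define W :: "word \<Rightarrow> bit fps" where
    "W v = Abs_fps (\<lambda>i. if i < length v then v ! i else 0)" for v
  define \<phi> :: "word \<Rightarrow> word" where
    "\<phi> v = map (\<lambda>n. fps_nth (g + W v * f) n) [0..<length v]" for v
  obtain f' where f': "f * f' = 1" using assms by (metis dvdE)
  have cong: "fps_nth (g + h * f) n = fps_nth (g + h' * f) n"
    if "\<And>i. i \<le> n \<Longrightarrow> fps_nth h i = fps_nth h' i" for h h' n
    using that by (simp add: fps_mult_nth)
  have len: "length (\<phi> v) = length v" for v by (simp add: \<phi>_def)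
  have pre: "\<phi> (map u [0..<n]) = map (fps_nth (g + Abs_fps u * f)) [0..<n]" for u n
  proof (rule nth_equalityI)
    fix i assume "i < length (\<phi> (map u [0..<n]))"
    then have i: "i < n" by (simp add: len)
    have "fps_nth (g + W (map u [0..<n]) * f) i = fps_nth (g + Abs_fps u * f) i"
      by (rule cong) (use i in \<open>simp add: W_def\<close>)
    then show "\<phi> (map u [0..<n]) ! i = map (fps_nth (g + Abs_fps u * f)) [0..<n] ! i"
      using i by (simp add: \<phi>_def)
  qed (simp add: len)
  have "inj \<phi>"
  proof
    fix v w :: word
    assume eq: "\<phi> v = \<phi> w"
    have l: "length v = length w" using eq len by metis
    have same: "fps_nth (W v * f) n = fps_nth (W w * f) n" if "n < length v" for n
    proof -
      have "\<phi> v ! n = \<phi> w ! n" using eq by simp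
      then have "fps_nth (g + W v * f) n = fps_nth (g + W w * f) n"
        using that l by (simp add: \<phi>_def del: fps_add_nth)
      then show ?thesis by (simp only: fps_add_nth add_left_cancel)
    qed
    show "v = w"
    proof (rule nth_equalityI[OF l])
      fix i assume i: "i < length v"
      have "fps_nth (W v * f * f') i = fps_nth (W w * f * f') i"
        unfolding fps_mult_nth[of "W v * f"] fps_mult_nth[of "W w * f"]
        using i same by (intro sum.cong) auto
      then have "fps_nth (W v) i = fps_nth (W w) i" by (simp add: mult.assoc f')
      then show "v ! i = w ! i" using i l by (simp add: W_def)
    qed
  qed
  moreover have "\<exists>y. \<phi> (v @ [x]) = \<phi> v @ [y]" for v x
  proof -
    let ?u = "\<lambda>i. (v @ [x]) ! i"
    have "v = map ?u [0..<length v]" by (intro nth_equalityI) (auto simp: nth_append)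
    moreover have "v @ [x] = map ?u [0..<Suc (length v)]"
      by (intro nth_equalityI) (auto simp: nth_append)
    ultimately have "\<phi> v = map (fps_nth (g + Abs_fps ?u * f)) [0..<length v]"
      "\<phi> (v @ [x]) = map (fps_nth (g + Abs_fps ?u * f)) [0..<Suc (length v)]"
      using pre by metis+
    then show ?thesis by auto
  qed
  ultimately have "\<phi> \<in> Aut_tree" using len by (intro Aut_treeI)
  moreover have "Abs_fps (boundary_act \<phi> u) = g + Abs_fps u * f" for u
    by (rule fps_ext) (simp add: boundary_act_def pre nth_append del: upt_Suc)
  ultimately show "\<exists>\<phi>. induced_by \<phi> (\<lambda>h. g + h * f)"
    unfolding induced_by_def by blast
next
  fix \<phi> \<psi>
  assume *: "induced_by \<phi> (\<lambda>h. g + h * f)" "induced_by \<psi> (\<lambda>h. g + h * f)"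
  then have "Abs_fps (boundary_act \<phi> u) = Abs_fps (boundary_act \<psi> u)" for u
    by (simp add: induced_by_def)
  then have "boundary_act \<phi> = boundary_act \<psi>"
    by (intro ext) (metis fps_nth_Abs_fps)
  with * show "\<phi> = \<psi>" by (auto simp: induced_by_def intro: boundary_act_inject)
qed

lemma induced_by_tau:
  "is_unit f \<Longrightarrow> induced_by (tau f g) (\<lambda>h. g + h * f)"
  using theI'[OF ex1_induced_by_affine] by (simp only: tau_def)

text \<open>The recursion of the theorem has exactly one solution among the automorphisms.\<close>

lemma abcd_recursion_unique:
  assumes "wreath_eq a b d (transpose 0 1) \<and> wreath_eq b d b (transpose 0 1) \<and>
       wreath_eq c a c id \<and> wreath_eq d c a id"
      "wreath_eq a' b' d' (transpose 0 1) \<and> wreath_eq b' d' b' (transpose 0 1) \<and>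
       wreath_eq c' a' c' id \<and> wreath_eq d' c' a' id"
    and aut: "{a, b, c, d, a', b', c', d'} \<subseteq> Aut_tree"
  shows "a = a' \<and> b = b' \<and> c = c' \<and> d = d'"
proof -
  have "a v = a' v \<and> b v = b' v \<and> c v = c' v \<and> d v = d' v" for v
  proof (induction v)
    case Nil
    show ?case using aut by (simp add: Aut_tree_def)
  next
    case (Cons x v)
    then show ?case using assms(1,2)
      by (cases x) (simp_all add: wreath_eq_def)
  qed
  then show ?thesis by blast
qed

fun abcd :: "nat \<Rightarrow> word \<Rightarrow> word" where
  "abcd i [] = []"
| "abcd i (x # v) =
     (if i = 0 then (x + 1) # abcd (if x = 0 then 1 else 3) v
      else if i = 1 then (x + 1) # abcd (if x = 0 then 3 else 1) v
      else if i = 2 then x # abcd (if x = 0 then 0 else 2) v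
      else x # abcd (if x = 0 then 2 else 0) v)"

lemma abcd_recursion_exists:
  "\<exists>a\<in>Aut_tree. \<exists>b\<in>Aut_tree. \<exists>c\<in>Aut_tree. \<exists>d\<in>Aut_tree.
     wreath_eq a b d (transpose 0 1) \<and> wreath_eq b d b (transpose 0 1) \<and>
     wreath_eq c a c id \<and> wreath_eq d c a id"
proof -
  have len: "length (abcd i v) = length v" for i v
    by (induction i v rule: abcd.induct) auto
  have inj: "abcd i v = abcd i w \<Longrightarrow> v = w" for i v w
  proof (induction i v arbitrary: w rule: abcd.induct)
    case (1 i)
    then show ?case using len[of i w] by simp
  next
    case (2 i x v)
    then show ?case by (cases w) (auto split: if_splits)
  qed
  have app: "\<exists>y. abcd i (v @ [x]) = abcd i v @ [y]" for i v x
    by (induction i v rule: abcd.induct) auto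
  have aut: "abcd i \<in> Aut_tree" for i
    using inj len app by (intro Aut_treeI) (auto intro: injI)
  have "wreath_eq (abcd 0) (abcd 1) (abcd 3) (transpose 0 1) \<and> wreath_eq (abcd 1) (abcd 3) (abcd 1) (transpose 0 1) \<and>
    wreath_eq (abcd 2) (abcd 0) (abcd 2) id \<and> wreath_eq (abcd 3) (abcd 2) (abcd 0) id"
    by (simp add: wreath_eq_def)
  with aut show ?thesis by blast
qed

end

theory Submission
  imports Defs
begin

text \<open>
  Affine transformations with a common multiplier are closed under passing to sections.
  Write an infinite word as \<open>x + t h\<close> with first letter \<open>x\<close> and tail \<open>h\<close>. Then
  \<open>\<tau>\<^sub>f\<^sub>,\<^sub>g\<close> sends it to \<open>(g + x f) + t h f\<close>, so if \<open>g + x f = y + t g'\<close> with a constant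
  \<open>y\<close>, the first letter of the image is \<open>y\<close> and the tail undergoes \<open>\<tau>\<^sub>f\<^sub>,\<^sub>g\<^sub>'\<close>: the multiplier
  \<open>f\<close> is unchanged, and only the translation part moves (\<open>wreath_eq_tau\<close>).

  For \<open>f = (t\<^sup>2 + t + 1) / (t + 1)\<^sup>2\<close>, the four translation parts \<open>1\<close>, \<open>t\<^sup>2 + t + 1\<close>, \<open>t\<close>,
  \<open>t\<^sup>2\<close> over \<open>(t + 1)\<^sup>3\<close> are carried into one another by this passage in exactly the
  pattern of the wreath recursion for \<open>a, b, c, d\<close>. The recursion has only one solution in
  tree automorphisms (\<open>abcd_recursion_unique\<close>), so the affine automorphisms are that solution.
\<close>

lemma tau_map_upt:
  assumes "is_unit f"
  shows "tau f g (map u [0..<n]) = map (fps_nth (g + Abs_fps u * f)) [0..<n]"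
proof -
  have ind: "tau f g \<in> Aut_tree" "Abs_fps (boundary_act (tau f g) u) = g + Abs_fps u * f"
    using induced_by_tau[OF assms, of g] by (simp_all add: induced_by_def)
  have "boundary_act (tau f g) u = fps_nth (g + Abs_fps u * f)"
    using ind(2) by (metis ext fps_nth_Abs_fps)
  then show ?thesis
    using boundary_act_prefix[OF ind(1), of u n] by simp
qed

text \<open>The wreath recursion acts on finite words, while \<open>\<tau>\<close> is given on power series; the
  finite word \<open>v\<close> is read here as a prefix of the infinite word \<open>nth v\<close>, whose unspecified
  letters beyond the end of \<open>v\<close> do not influence the first \<open>length v\<close> coefficients.\<close>

lemma tau_Cons:
  assumes f: "is_unit f" and sec: "g + fps_const x * f = fps_const y + fps_X * g'"
  shows "tau f g (x # v) = y # tau f g' v"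
proof -
  let ?n = "length v"
  let ?h = "Abs_fps (nth v)"
  have split: "Abs_fps (nth (x # v)) = fps_const x + fps_X * ?h"
    by (rule fps_ext) (auto simp: nth_Cons split: nat.split)
  have "g + Abs_fps (nth (x # v)) * f = (g + fps_const x * f) + fps_X * (?h * f)"
    by (simp add: split algebra_simps)
  also have "\<dots> = fps_const y + fps_X * (g' + ?h * f)"
    by (simp only: sec) (simp add: algebra_simps)
  finally have img: "g + Abs_fps (nth (x # v)) * f = fps_const y + fps_X * (g' + ?h * f)" .
  have "tau f g (x # v) = tau f g (map (nth (x # v)) [0..<Suc ?n])"
    by (metis map_nth length_Cons)
  also have "\<dots> = map (fps_nth (fps_const y + fps_X * (g' + ?h * f))) [0..<Suc ?n]"
    by (simp only: tau_map_upt[OF f] img)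
  also have "\<dots> = y # map (fps_nth (g' + ?h * f)) [0..<?n]"
    by (simp add: map_upt_Suc del: upt_Suc)
  also have "map (fps_nth (g' + ?h * f)) [0..<?n] = tau f g' v"
    using tau_map_upt[OF f, of g' "nth v" ?n] by (simp add: map_nth)
  finally show ?thesis .
qed

lemma wreath_eq_tau:
  assumes "is_unit f"
    and "g = fps_const (\<rho> 0) + fps_X * g0"
    and "g + f = fps_const (\<rho> 1) + fps_X * g1"
  shows "wreath_eq (tau f g) (tau f g0) (tau f g1) \<rho>"
  using assms by (simp add: wreath_eq_def tau_Cons)

lemma bit_fps_add_self: "(h :: bit fps) + h = 0"
proof (rule fps_ext)
  fix n
  have "x + x = 0" for x :: bit by simp
  then show "fps_nth (h + h) n = fps_nth 0 n" by (simp only: fps_add_nth fps_zero_nth)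
qed

lemma bit_fps_add_self_left: "(h :: bit fps) + (h + k) = k"
  by (simp only: bit_fps_add_self add_0_left flip: add.assoc)

text \<open>Expands both sides of an identity between polynomials in \<open>t\<close> and cancels equal
  monomials in pairs, which decides such an identity in characteristic two.\<close>

lemmas bit_poly_simps =
  bit_fps_add_self bit_fps_add_self_left algebra_simps power2_eq_square power3_eq_cube

text \<open>The denominator \<open>t\<^sup>2 + 1\<close> is \<open>(t + 1)\<^sup>2\<close> in characteristic two, so \<open>(t + 1)\<^sup>3\<close> is a
  common denominator of the multiplier and of the translation parts.\<close>

lemma multiplier_common_denominator:
  "(fps_X^2 + fps_X + 1) / (fps_X^2 + 1) * (fps_X + 1)^3
     = (fps_X^2 + fps_X + 1) * (fps_X + 1 :: bit fps)"
proof -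
  have "(fps_X + 1) ^ 3 = (fps_X ^ 2 + 1) * (fps_X + 1 :: bit fps)"
    by (simp add: bit_poly_simps)
  moreover have "is_unit (fps_X ^ 2 + 1 :: bit fps)"
    by (simp add: fps_is_unit_iff)
  ultimately show ?thesis
    by (simp only: unit_div_mult_self flip: mult.assoc)
qed

theorem theorem3p3:
  fixes a b c d :: "word \<Rightarrow> word"
  assumes "a \<in> Aut_tree" "b \<in> Aut_tree" "c \<in> Aut_tree" "d \<in> Aut_tree"
    and "wreath_eq a b d (transpose 0 1)"
    and "wreath_eq b d b (transpose 0 1)"
    and "wreath_eq c a c id"
    and "wreath_eq d c a id"
  shows "{a, b, c, d} \<subseteq> Aff_tree
    \<and> a = tau ((fps_X^2 + fps_X + 1) / (fps_X^2 + 1)) (1 / (fps_X + 1)^3)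
    \<and> b = tau ((fps_X^2 + fps_X + 1) / (fps_X^2 + 1)) ((fps_X^2 + fps_X + 1) / (fps_X + 1)^3)
    \<and> c = tau ((fps_X^2 + fps_X + 1) / (fps_X^2 + 1)) (fps_X / (fps_X + 1)^3)
    \<and> d = tau ((fps_X^2 + fps_X + 1) / (fps_X^2 + 1)) (fps_X^2 / (fps_X + 1)^3)"
proof -
  let ?f = "(fps_X^2 + fps_X + 1) / (fps_X^2 + 1) :: bit fps"
  let ?A = "1 / (fps_X + 1)^3 :: bit fps"
  let ?B = "(fps_X^2 + fps_X + 1) / (fps_X + 1)^3 :: bit fps"
  let ?C = "fps_X / (fps_X + 1)^3 :: bit fps"
  let ?D = "fps_X^2 / (fps_X + 1)^3 :: bit fps"
  have unit: "is_unit ?f"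
    by (simp add: fps_is_unit_iff fps_divide_unit)
  have denom: "is_unit ((fps_X + 1)^3 :: bit fps)"
    by (simp add: fps_is_unit_iff)
  then have cancel: "x * (fps_X + 1)^3 = y * (fps_X + 1)^3 \<Longrightarrow> x = y" for x y :: "bit fps"
    by (metis nonzero_mult_div_cancel_right not_is_unit_0)
  note clear = distrib_right mult.assoc mult_1_left
    unit_div_mult_self[OF denom] multiplier_common_denominator
  \<comment> \<open>The section at \<open>0\<close> comes from \<open>g\<close>, that at \<open>1\<close> from \<open>g + f\<close>. After multiplication by
    \<open>(t + 1)\<^sup>3\<close> each is an identity of polynomials over \<open>\<int>/2\<close>.\<close>
  have secA: "?A = 1 + fps_X * ?B" "?A + ?f = fps_X * ?D"
    by (rule cancel, simp only: clear, simp add: bit_poly_simps)+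
  have secB: "?B = 1 + fps_X * ?D" "?B + ?f = fps_X * ?B"
    by (rule cancel, simp only: clear, simp add: bit_poly_simps)+
  have secC: "?C = fps_X * ?A" "?C + ?f = 1 + fps_X * ?C"
    by (rule cancel, simp only: clear, simp add: bit_poly_simps)+
  have secD: "?D = fps_X * ?C" "?D + ?f = 1 + fps_X * ?A"
    by (rule cancel, simp only: clear, simp add: bit_poly_simps)+
  have wreath:
    "wreath_eq (tau ?f ?A) (tau ?f ?B) (tau ?f ?D) (transpose 0 1) \<and>
     wreath_eq (tau ?f ?B) (tau ?f ?D) (tau ?f ?B) (transpose 0 1) \<and>
     wreath_eq (tau ?f ?C) (tau ?f ?A) (tau ?f ?C) id \<and>
     wreath_eq (tau ?f ?D) (tau ?f ?C) (tau ?f ?A) id"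
    by (intro conjI; rule wreath_eq_tau[OF unit];
        simp only: transpose_apply_first transpose_apply_second id_apply
          fps_const_0_eq_0 fps_const_1_eq_1 add_0_left;
        rule secA secB secC secD)
  have aut: "tau ?f g \<in> Aut_tree" for g
    using induced_by_tau[OF unit] by (simp add: induced_by_def)
  have eq: "a = tau ?f ?A \<and> b = tau ?f ?B \<and> c = tau ?f ?C \<and> d = tau ?f ?D"
    by (rule abcd_recursion_unique[OF _ wreath]) (use assms aut in simp_all)
  moreover have "{a, b, c, d} \<subseteq> Aff_tree"
    unfolding Aff_tree_def using eq unit by blast
  ultimately show ?thesis by blast
qed

end
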